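(* Consider the system of four first-order partial differential equations $$(-1)^p\beta_p=\alpha_q\,e^{(-1)^p\delta}\sec\gamma-\alpha_p\tan\gamma\quad\text{whenever }\{p,q\}=\{3,4\},$$ $$(-1)^\lambda\delta_\lambda=\gamma_\mu\,e^{(-1)^\lambda\beta}\sec\alpha-\gamma_\lambda\tan\alpha\quad\text{whenever }\{\lambda,\mu\}=\{1,2\},$$ imposed on four real-valued functions $\alpha,\beta,\gamma,\delta$ of the variables $x^1,x^2,x^3,x^4$, with $\alpha,\gamma$ taking values in $(-\pi/2,\pi/2)$. Real-analytic solutions $(\alpha,\beta,\gamma,\delta)$ to this system exist on a neighborhood of any $z\in\mathbb{R}^4$ and realize all first-order initial data satisfying the system at $z$. That is, given $z\in\mathbb{R}^4$ and any real numbers prescribed as the values at $z$ of $\alpha,\beta,\gamma,\delta$ (those for $\alpha,\gamma$ lying in $(-\pi/2,\pi/2)$) and of all their first partial derivatives $\alpha_j,\beta_j,\gamma_j,\delta_j$, $j=1,2,3,4$, such that these numbers satisfy the four equations above, there exists a real-analytic solution $(\alpha,\beta,\gamma,\delta)$ of the system on some neighborhood of $z$ having at $z$ the prescribed values and first partial derivatives.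
   Context: Subscripts of $\alpha,\beta,\gamma,\delta$ denote partial derivatives with respect to the corresponding coordinates $x^1,\dots,x^4$ of $\mathbb{R}^4$; there is no summation over repeated indices. *)

theory Defs
  imports "HOL-Analysis.Analysis"
begin

text \<open>Real analyticity in several real variables: local expansion in a multivariate power series.
  Multi-indices are vectors of natural numbers; \<open>has_sum\<close> is unconditional, hence absolute,
  convergence. Only used for open sets.\<close>

definition real_analytic_on :: "(real ^ 'n \<Rightarrow> real) \<Rightarrow> (real ^ 'n) set \<Rightarrow> bool"
  where "real_analytic_on f S \<longleftrightarrow>
    (\<forall>a\<in>S. \<exists>r>0. \<exists>c :: nat ^ 'n \<Rightarrow> real. \<forall>x\<in>ball a r.
       ((\<lambda>k. c k * (\<Prod>i\<in>UNIV. (x $ i - a $ i) ^ (k $ i))) has_sum f x) UNIV)"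

definition partial_derivs :: "(real ^ 'n \<Rightarrow> real) \<Rightarrow> real ^ 'n \<Rightarrow> real ^ 'n"
  where "partial_derivs f x = (\<chi> j. deriv (\<lambda>t. f (x + t *\<^sub>R axis j 1)) 0)"

text \<open>The system as a relation between the values \<open>a, b, c, d\<close> of the functions
  \<open>\<alpha>, \<beta>, \<gamma>, \<delta>\<close> at a point and their vectors \<open>A, B, C, D\<close> of first partial derivatives there.
  The coordinate labels are natural numbers, as they also occur as exponents of \<open>-1\<close>;
  \<open>of_nat\<close> embeds them into the index type \<open>4\<close>, where the label 4 coincides with 0.
  The secant is \<open>1 / cos\<close>.\<close>

definition pde_relation ::
    "real \<Rightarrow> real \<Rightarrow> real \<Rightarrow> real \<Rightarrow> real ^ 4 \<Rightarrow> real ^ 4 \<Rightarrow> real ^ 4 \<Rightarrow> real ^ 4 \<Rightarrow> bool"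
  where "pde_relation a b c d A B C D \<longleftrightarrow>
    (\<forall>p q :: nat. {p, q} = {3, 4} \<longrightarrow>
       (-1) ^ p * B $ of_nat p
         = A $ of_nat q * exp ((-1) ^ p * d) * (1 / cos c) - A $ of_nat p * tan c) \<and>
    (\<forall>l m :: nat. {l, m} = {1, 2} \<longrightarrow>
       (-1) ^ l * D $ of_nat l
         = C $ of_nat m * exp ((-1) ^ l * b) * (1 / cos a) - C $ of_nat l * tan a)"

lemma pde_relation_explicit:
  "pde_relation a b c d A B C D \<longleftrightarrow>
     - B $ 3 = A $ 4 * exp (- d) / cos c - A $ 3 * tan c \<and>
     B $ 4 = A $ 3 * exp d / cos c - A $ 4 * tan c \<and>
     - D $ 1 = C $ 2 * exp (- b) / cos a - C $ 1 * tan a \<and>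
     D $ 2 = C $ 1 * exp b / cos a - C $ 2 * tan a"
proof -
  have "(\<forall>p q. {p, q} = {u, v} \<longrightarrow> P p q) \<longleftrightarrow> P u v \<and> P v u" for u v :: nat and P
    by (auto simp: doubleton_eq_iff)
  then show ?thesis
    unfolding pde_relation_def by simp
qed

definition is_solution_on ::
    "(real ^ 4 \<Rightarrow> real) \<Rightarrow> (real ^ 4 \<Rightarrow> real) \<Rightarrow> (real ^ 4 \<Rightarrow> real) \<Rightarrow> (real ^ 4 \<Rightarrow> real) \<Rightarrow>
      (real ^ 4) set \<Rightarrow> bool"
  where "is_solution_on \<alpha> \<beta> \<gamma> \<delta> U \<longleftrightarrow>
    (\<forall>x\<in>U. \<alpha> x \<in> {- pi/2 <..< pi/2} \<and> \<gamma> x \<in> {- pi/2 <..< pi/2} \<and>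
       pde_relation (\<alpha> x) (\<beta> x) (\<gamma> x) (\<delta> x)
         (partial_derivs \<alpha> x) (partial_derivs \<beta> x) (partial_derivs \<gamma> x) (partial_derivs \<delta> x))"

end

theory Submission
  imports Defs "HOL-Complex_Analysis.Cauchy_Integral_Formula"
begin

text \<open>With \<open>W = \<beta> - \<i> \<alpha>\<close>, \<open>Z = \<delta> - \<i> \<gamma>\<close> the system reads
  \<open>W\<^sub>4 = \<i> e\<^sup>Z W\<^sub>3\<close>, \<open>Z\<^sub>2 = \<i> e\<^sup>W Z\<^sub>1\<close>; for \<open>P = \<i> e\<^sup>Z\<close> and
  \<open>Q = \<i> e\<^sup>W\<close>, which take values in the upper half plane, it becomes
  \<open>Q\<^sub>4 = P Q\<^sub>3\<close>, \<open>P\<^sub>2 = Q P\<^sub>1\<close>. If \<open>P\<^sub>1 \<noteq> 0\<close> at the base point, the level sets of \<open>P\<close>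
  can be written as graphs over the other coordinates, which linearizes the equations; a suitable
  quadratic choice gives rational solutions \<open>P\<close>, \<open>Q\<close> with enough parameters to match every
  admissible first-order jet. The case \<open>Q\<^sub>3 \<noteq> 0\<close> is symmetric, and if both derivatives vanish,
  affine \<open>P(x\<^sup>3, x\<^sup>4)\<close> and \<open>Q(x\<^sup>1, x\<^sup>2)\<close> suffice. In particular the Cauchy--Kovalevskaya
  theorem is not needed.\<close>

section \<open>Multivariate monomials and their estimates\<close>

definition monomial :: "nat ^ 'n \<Rightarrow> real ^ 'n \<Rightarrow> real"
  where "monomial k x = (\<Prod>i\<in>UNIV. (x $ i) ^ (k $ i))"

lemma monomial_0 [simp]: "monomial 0 x = 1"
  by (simp add: monomial_def)

lemma monomial_add: "monomial (k + l) x = monomial k x * monomial l x"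
  by (simp add: monomial_def power_add prod.distrib)

lemma monomial_axis [simp]: "monomial (axis i 1) x = x $ i"
proof -
  have "monomial (axis i 1) x = (\<Prod>j\<in>UNIV. if j = i then x $ j else 1)"
    unfolding monomial_def by (rule prod.cong) (auto simp: axis_def)
  then show ?thesis by simp
qed

lemma monomial_at_0: "k \<noteq> 0 \<Longrightarrow> monomial k 0 = 0"
  by (auto simp: monomial_def vec_eq_iff)

lemma monomial_vec_pos: "r > 0 \<Longrightarrow> monomial k (vec r) > 0"
  by (auto simp: monomial_def intro!: prod_pos)

text \<open>Each coordinate is bounded by the Euclidean norm, so the weight
  \<open>monomial k (vec r)\<close> controls the monomial on the whole ball of radius
  \<open>r\<close>.\<close>

lemma abs_monomial_le:
  assumes "norm x \<le> r"
  shows "\<bar>monomial k x\<bar> \<le> monomial k (vec r)"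
  unfolding monomial_def abs_prod
proof (rule prod_mono)
  fix i
  have "\<bar>x $ i\<bar> \<le> r" using assms component_le_norm_cart[of x i] by linarith
  then show "0 \<le> \<bar>(x $ i) ^ (k $ i)\<bar> \<and> \<bar>(x $ i) ^ (k $ i)\<bar> \<le> (vec r $ i) ^ (k $ i)"
    by (simp add: power_abs power_mono)
qed

text \<open>Some exponent is at least 1, so scaling produces at least one factor \<open>u\<close>;
  the other powers of \<open>u\<close> are at most 1.\<close>

lemma monomial_vec_scale_le:
  assumes "0 \<le> u" "u \<le> 1" "0 \<le> r" "k \<noteq> 0"
  shows "monomial k (vec (u * r)) \<le> u * monomial k (vec r)"
proof -
  obtain i where i: "k $ i \<noteq> 0" using assms(4) by (auto simp: vec_eq_iff)
  have "(\<Prod>j\<in>UNIV. u ^ (k $ j)) = u ^ (k $ i) * (\<Prod>j\<in>UNIV - {i}. u ^ (k $ j))"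
    by (simp add: prod.remove)
  also have "\<dots> \<le> u ^ (k $ i) * 1"
    using assms by (intro mult_left_mono prod_le_1) (auto simp: power_le_one)
  also have "\<dots> \<le> u"
    using assms i power_decreasing[of 1 "k $ i" u] by simp
  finally have "(\<Prod>j\<in>UNIV. u ^ (k $ j)) * monomial k (vec r) \<le> u * monomial k (vec r)"
    using assms by (intro mult_right_mono) (auto simp: monomial_def prod_nonneg)
  then show ?thesis
    by (simp add: monomial_def power_mult_distrib prod.distrib)
qed

section \<open>Power series with absolutely summable coefficients\<close>

text \<open>The weighted coefficient sum \<open>s\<close> behaves like a Banach algebra norm; this is what makes
  composition with a one-variable power series work.\<close>

definition power_series_bound :: "(real ^ 'n \<Rightarrow> complex) \<Rightarrow> real ^ 'n \<Rightarrow> real \<Rightarrow> real \<Rightarrow> bool"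
  where "power_series_bound f a r s \<longleftrightarrow> r > 0 \<and>
    (\<exists>c. ((\<lambda>k. norm (c k) * monomial k (vec r)) has_sum s) UNIV \<and>
      (\<forall>x\<in>ball a r. ((\<lambda>k. c k * of_real (monomial k (x - a))) has_sum f x) UNIV))"

text \<open>The fibres of \<open>\<kappa>\<close> partition \<open>I\<close>, so this is Fubini for
  sums. It serves to collect all terms with the same exponent.\<close>

lemma has_sum_fibres:
  fixes f :: "'i \<Rightarrow> 'b :: banach" and \<kappa> :: "'i \<Rightarrow> 'k"
  assumes "(\<lambda>i. norm (f i)) summable_on I" and "(f has_sum s) I"
  shows "((\<lambda>k. \<Sum>\<^sub>\<infinity>i\<in>{i\<in>I. \<kappa> i = k}. f i) has_sum s) UNIV"
proof (rule has_sum_SigmaD)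
  have bij: "bij_betw snd (Sigma UNIV (\<lambda>k. {i\<in>I. \<kappa> i = k})) I"
    by (rule bij_betwI[where g = "\<lambda>i. (\<kappa> i, i)"]) auto
  show "((\<lambda>p. f (snd p)) has_sum s) (Sigma UNIV (\<lambda>k. {i\<in>I. \<kappa> i = k}))"
    using has_sum_reindex_bij_betw[OF bij, of f s] assms(2) by simp
  fix k
  have "(\<lambda>i. norm (f i)) summable_on {i\<in>I. \<kappa> i = k}"
    using assms(1) by (rule summable_on_subset_banach) auto
  then show "((\<lambda>i. f (snd (k, i))) has_sum (\<Sum>\<^sub>\<infinity>i\<in>{i\<in>I. \<kappa> i = k}. f i)) {i\<in>I. \<kappa> i = k}"
    by (simp add: abs_summable_summable)
qed

lemma abs_summable_on_monomials:
  fixes e :: "'i \<Rightarrow> complex"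
  assumes "(\<lambda>i. norm (e i) * monomial (\<kappa> i) (vec r)) summable_on I" and "norm x \<le> r"
  shows "(\<lambda>i. norm (e i * of_real (monomial (\<kappa> i) x))) summable_on I"
  by (rule summable_on_comparison_test[OF assms(1)])
    (auto simp: norm_mult intro!: mult_left_mono abs_monomial_le assms)

text \<open>Expansions may be indexed by any set, with repeated exponents: collecting equal
  exponents gives a genuine power series, and by the triangle inequality this cannot increase the
  weighted norm. Products and compositions arise in this form.\<close>

lemma power_series_boundI:
  fixes e :: "'i \<Rightarrow> complex" and \<kappa> :: "'i \<Rightarrow> nat ^ 'n"
  assumes r: "r > 0"
    and s: "((\<lambda>i. norm (e i) * monomial (\<kappa> i) (vec r)) has_sum s) I"
    and f: "\<And>x. x \<in> ball a r \<Longrightarrow> ((\<lambda>i. e i * of_real (monomial (\<kappa> i) (x - a))) has_sum f x) I"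
  shows "\<exists>s'\<le>s. power_series_bound f a r s'"
proof -
  define fib where "fib k = {i\<in>I. \<kappa> i = k}" for k
  define c where "c k = (\<Sum>\<^sub>\<infinity>i\<in>fib k. e i)" for k
  let ?t = "\<lambda>i. norm (e i) * monomial (\<kappa> i) (vec r)"
  have nn: "?t i \<ge> 0" for i using monomial_vec_pos[OF r] less_imp_le by (intro mult_nonneg_nonneg) auto
  have sI: "?t summable_on I" using s by (rule has_sum_imp_summable)
  have tfib: "((\<lambda>k. \<Sum>\<^sub>\<infinity>i\<in>fib k. ?t i) has_sum s) UNIV"
    unfolding fib_def using nn sI by (intro has_sum_fibres s) simp
  have abs: "(\<lambda>i. norm (e i)) summable_on fib k" for k
  proof -
    \<comment> \<open>On a fibre the weight is the positive constant
      \<open>monomial k (vec r)\<close> and can be divided out.\<close>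
    have "?t summable_on fib k" using sI by (rule summable_on_subset_banach) (auto simp: fib_def)
    then have "(\<lambda>i. norm (e i) * monomial k (vec r)) summable_on fib k"
      by (rule summable_on_cong[THEN iffD1, rotated]) (auto simp: fib_def)
    then show ?thesis
      using summable_on_cmult_left'[of "monomial k (vec r)" "\<lambda>i. norm (e i)" "fib k"]
        monomial_vec_pos[OF r, of k] by simp
  qed
  have le: "norm (c k) * monomial k (vec r) \<le> (\<Sum>\<^sub>\<infinity>i\<in>fib k. ?t i)" for k
  proof -
    have "(\<Sum>\<^sub>\<infinity>i\<in>fib k. ?t i) = (\<Sum>\<^sub>\<infinity>i\<in>fib k. norm (e i) * monomial k (vec r))"
      by (rule infsum_cong) (auto simp: fib_def)
    also have "\<dots> = (\<Sum>\<^sub>\<infinity>i\<in>fib k. norm (e i)) * monomial k (vec r)"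
      by (rule infsum_cmult_left')
    finally show ?thesis
      using norm_infsum_bound[OF abs[of k]] monomial_vec_pos[OF r, of k]
      by (simp add: c_def)
  qed
  have csum: "(\<lambda>k. norm (c k) * monomial k (vec r)) summable_on UNIV"
    by (rule summable_on_comparison_test[OF has_sum_imp_summable[OF tfib]])
      (use le monomial_vec_pos[OF r] less_imp_le in \<open>auto intro!: mult_nonneg_nonneg\<close>)
  define s' where "s' = (\<Sum>\<^sub>\<infinity>k. norm (c k) * monomial k (vec r))"
  have s': "((\<lambda>k. norm (c k) * monomial k (vec r)) has_sum s') UNIV"
    using csum by (simp add: s'_def)
  have "s' \<le> s" by (rule has_sum_mono[OF s' tfib]) (use le in auto)
  moreover have "power_series_bound f a r s'"
    unfolding power_series_bound_def
  proof (intro conjI exI ballI)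
    show "((\<lambda>k. norm (c k) * monomial k (vec r)) has_sum s') UNIV" by fact
    fix x assume x: "x \<in> ball a r"
    then have "norm (x - a) \<le> r" by (simp add: dist_norm norm_minus_commute)
    then have "((\<lambda>k. \<Sum>\<^sub>\<infinity>i\<in>fib k. e i * of_real (monomial (\<kappa> i) (x - a))) has_sum f x) UNIV"
      unfolding fib_def by (intro has_sum_fibres f x abs_summable_on_monomials[OF sI])
    moreover have "(\<Sum>\<^sub>\<infinity>i\<in>fib k. e i * of_real (monomial (\<kappa> i) (x - a)))
        = c k * of_real (monomial k (x - a))" for k
    proof -
      have "(\<Sum>\<^sub>\<infinity>i\<in>fib k. e i * of_real (monomial (\<kappa> i) (x - a)))
        = (\<Sum>\<^sub>\<infinity>i\<in>fib k. e i * of_real (monomial k (x - a)))"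
        by (rule infsum_cong) (auto simp: fib_def)
      then show ?thesis unfolding c_def by (simp add: infsum_cmult_left')
    qed
    ultimately show "((\<lambda>k. c k * of_real (monomial k (x - a))) has_sum f x) UNIV" by simp
  qed (fact r)
  ultimately show ?thesis by blast
qed

lemma has_sum_Times_mult:
  fixes f :: "'a \<Rightarrow> 'c :: {banach, real_normed_field}"
  assumes "(f has_sum s) A" "(g has_sum t) B" "(\<lambda>i. norm (f i)) summable_on A" "(\<lambda>i. norm (g i)) summable_on B"
  shows "((\<lambda>p. f (fst p) * g (snd p)) has_sum (s * t)) (A \<times> B)"
proof (rule has_sum_SigmaI)
  show "((\<lambda>y. f (fst (x, y)) * g (snd (x, y))) has_sum f x * t) B" for x
    using has_sum_cmult_right[OF assms(2), of "f x"] by simp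
  show "((\<lambda>x. f x * t) has_sum s * t) A"
    by (rule has_sum_cmult_left[OF assms(1)])
  have "(\<lambda>p. norm (f (fst p) * g (snd p))) summable_on A \<times> B"
  proof (rule summable_on_SigmaI)
    show "((\<lambda>y. norm (f (fst (x, y)) * g (snd (x, y)))) has_sum norm (f x) * (\<Sum>\<^sub>\<infinity>y\<in>B. norm (g y))) B" for x
      using has_sum_cmult_right[OF has_sum_infsum[OF assms(4)], of "norm (f x)"] by (simp add: norm_mult)
    show "(\<lambda>x. norm (f x) * (\<Sum>\<^sub>\<infinity>y\<in>B. norm (g y))) summable_on A"
      by (rule summable_on_cmult_left[OF assms(3)])
  qed auto
  then show "(\<lambda>p. f (fst p) * g (snd p)) summable_on A \<times> B"
    by (rule abs_summable_summable)
qed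

text \<open>The Cauchy product is first indexed by pairs of exponents, where the weighted norms
  multiply because monomials do; pairs with equal sum are then collected.\<close>

lemma power_series_bound_mult:
  assumes "power_series_bound f a r s" "power_series_bound g a r t"
  shows "\<exists>u\<le>s * t. power_series_bound (\<lambda>x. f x * g x) a r u"
proof -
  from assms(1) obtain c where r: "r > 0"
    and c: "((\<lambda>k. norm (c k) * monomial k (vec r)) has_sum s) UNIV"
    and f: "\<And>x. x \<in> ball a r \<Longrightarrow> ((\<lambda>k. c k * of_real (monomial k (x - a))) has_sum f x) UNIV"
    unfolding power_series_bound_def by blast
  from assms(2) obtain d where
        d: "((\<lambda>k. norm (d k) * monomial k (vec r)) has_sum t) UNIV"
    and g: "\<And>x. x \<in> ball a r \<Longrightarrow> ((\<lambda>k. d k * of_real (monomial k (x - a))) has_sum g x) UNIV"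
    unfolding power_series_bound_def by blast
  have pos: "0 \<le> monomial k (vec r)" for k :: "nat ^ 'a" using monomial_vec_pos[OF r, of k] by simp
  show ?thesis
  proof (rule power_series_boundI[OF r, where I = "UNIV \<times> UNIV"
        and e = "\<lambda>p. c (fst p) * d (snd p)" and \<kappa> = "\<lambda>p. fst p + snd p"])
    have "((\<lambda>p. norm (c (fst p)) * monomial (fst p) (vec r) * (norm (d (snd p)) * monomial (snd p) (vec r)))
        has_sum s * t) (UNIV \<times> UNIV)"
      by (rule has_sum_Times_mult[OF c d]) (use has_sum_imp_summable[OF c] has_sum_imp_summable[OF d] pos
         in \<open>simp_all add: abs_mult\<close>)
    then show "((\<lambda>p. norm (c (fst p) * d (snd p)) * monomial (fst p + snd p) (vec r)) has_sum s * t) (UNIV \<times> UNIV)"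
      by (simp add: norm_mult monomial_add mult_ac)
    fix x assume x: "x \<in> ball a r"
    then have n: "norm (x - a) \<le> r" by (simp add: dist_norm norm_minus_commute)
    have "((\<lambda>p. c (fst p) * of_real (monomial (fst p) (x - a)) * (d (snd p) * of_real (monomial (snd p) (x - a))))
        has_sum f x * g x) (UNIV \<times> UNIV)"
      by (rule has_sum_Times_mult[OF f[OF x] g[OF x]])
        (rule abs_summable_on_monomials[OF has_sum_imp_summable[OF c] n]
          abs_summable_on_monomials[OF has_sum_imp_summable[OF d] n])+
    then show "((\<lambda>p. c (fst p) * d (snd p) * of_real (monomial (fst p + snd p) (x - a))) has_sum f x * g x) (UNIV \<times> UNIV)"
      by (simp add: monomial_add mult_ac)
  qed
qed

lemma power_series_bound_nonneg: "power_series_bound f a r s \<Longrightarrow> s \<ge> 0"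
  unfolding power_series_bound_def
  by (auto elim!: has_sum_nonneg intro!: mult_nonneg_nonneg less_imp_le[OF monomial_vec_pos])

lemma power_series_bound_norm_le:
  assumes "power_series_bound f a r s" and "x \<in> ball a r"
  shows "norm (f x) \<le> s"
proof -
  from assms obtain c
    where c: "((\<lambda>k. norm (c k) * monomial k (vec r)) has_sum s) UNIV"
    and f: "((\<lambda>k. c k * of_real (monomial k (x - a))) has_sum f x) UNIV"
    unfolding power_series_bound_def by blast
  have n: "norm (x - a) \<le> r" using assms(2) by (simp add: dist_norm norm_minus_commute)
  have "norm (f x) \<le> (\<Sum>\<^sub>\<infinity>k. norm (c k * of_real (monomial k (x - a))))"
    by (rule norm_has_sum_bound[OF _ f])
      (rule has_sum_infsum, rule abs_summable_on_monomials[OF has_sum_imp_summable[OF c] n])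
  also have "\<dots> \<le> s"
    by (rule has_sum_mono[OF has_sum_infsum[OF abs_summable_on_monomials[OF has_sum_imp_summable[OF c] n]] c])
     (auto simp: norm_mult intro!: mult_left_mono abs_monomial_le n)
  finally show ?thesis .
qed

lemma power_series_bound_const: "r > 0 \<Longrightarrow> power_series_bound (\<lambda>x. w) a r (norm w)"
  unfolding power_series_bound_def
proof (intro conjI exI[of _ "\<lambda>k. if k = 0 then w else 0"] ballI)
  show "((\<lambda>k. norm (if k = 0 then w else 0) * monomial k (vec r)) has_sum norm w) UNIV"
    by (rule has_sum_finite_neutralI[of "{0}"]) auto
  show "((\<lambda>k. (if k = 0 then w else 0) * of_real (monomial k (x - a))) has_sum w) UNIV" for x
    by (rule has_sum_finite_neutralI[of "{0}"]) auto
qed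

lemma power_series_bound_power:
  assumes "power_series_bound f a r s"
  shows "\<exists>u\<le>s ^ j. power_series_bound (\<lambda>x. f x ^ j) a r u"
proof (induction j)
  case 0
  have "r > 0" using assms by (simp add: power_series_bound_def)
  then have "power_series_bound (\<lambda>x. 1) a r (norm (1::complex))" by (rule power_series_bound_const)
  then show ?case by auto
next
  case (Suc j)
  then obtain u where u: "u \<le> s ^ j" "power_series_bound (\<lambda>x. f x ^ j) a r u" by blast
  from power_series_bound_mult[OF assms u(2)] obtain v
    where v: "v \<le> s * u" "power_series_bound (\<lambda>x. f x * f x ^ j) a r v" by blast
  have "v \<le> s * s ^ j"
    using v(1) u(1) power_series_bound_nonneg[OF assms] mult_left_mono by fastforce
  then show ?case using v(2) by auto
qed

text \<open>The \<open>j\<close>-th power of \<open>f\<close> has weighted norm at most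
  \<open>s ^ j\<close>, so the double series from expanding every power is dominated by the
  convergent series of \<open>norm (b j) * s ^ j\<close> and may be rearranged.\<close>

lemma power_series_bound_compose:
  assumes f: "power_series_bound f a r s"
    and b: "summable (\<lambda>j. norm (b j) * s ^ j)"
    and g: "\<And>w. norm w \<le> s \<Longrightarrow> (\<lambda>j. b j * w ^ j) sums g w"
  shows "\<exists>t. power_series_bound (\<lambda>x. g (f x)) a r t"
proof -
  have r: "r > 0" using f by (simp add: power_series_bound_def)
  have s0: "s \<ge> 0" by (rule power_series_bound_nonneg[OF f])
  have pos: "0 \<le> monomial k (vec r)" for k :: "nat ^ 'a" using monomial_vec_pos[OF r, of k] by simp
  \<comment> \<open>Coefficients and norm are packed into one pair so that a single use of choice
    selects both for every \<open>j\<close>.\<close>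
  have "\<forall>j. \<exists>cu. snd cu \<le> s ^ j \<and> ((\<lambda>k. norm (fst cu k) * monomial k (vec r)) has_sum snd cu) UNIV \<and>
      (\<forall>x\<in>ball a r. ((\<lambda>k. fst cu k * of_real (monomial k (x - a))) has_sum f x ^ j) UNIV)"
    using power_series_bound_power[OF f] unfolding power_series_bound_def by fastforce
  from choice[OF this] obtain cu where
    cu: "\<And>j. snd (cu j) \<le> s ^ j \<and> ((\<lambda>k. norm (fst (cu j) k) * monomial k (vec r)) has_sum snd (cu j)) UNIV \<and>
      (\<forall>x\<in>ball a r. ((\<lambda>k. fst (cu j) k * of_real (monomial k (x - a))) has_sum f x ^ j) UNIV)" by blast
  define c where "c j = fst (cu j)" for j
  define u where "u j = snd (cu j)" for j
  have u: "u j \<le> s ^ j"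
    and c: "((\<lambda>k. norm (c j k) * monomial k (vec r)) has_sum u j) UNIV"
    and fj: "x \<in> ball a r \<Longrightarrow> ((\<lambda>k. c j k * of_real (monomial k (x - a))) has_sum f x ^ j) UNIV" for j x
    using cu[of j] unfolding c_def u_def by blast+
  have u0: "0 \<le> u j" for j by (rule has_sum_nonneg[OF c]) (auto intro!: mult_nonneg_nonneg pos)
  let ?e = "\<lambda>p. b (fst p) * c (fst p) (snd p)"
  let ?t = "\<lambda>p. norm (?e p) * monomial (snd p) (vec r)"
  have sum: "?t summable_on (UNIV \<times> UNIV)"
  proof (rule summable_on_SigmaI)
    show "((\<lambda>k. ?t (j, k)) has_sum norm (b j) * u j) UNIV" for j
      using has_sum_cmult_right[OF c[of j], of "norm (b j)"] by (simp add: norm_mult mult_ac)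
    have "(\<lambda>j. norm (b j) * s ^ j) summable_on UNIV"
      using b s0 by (intro norm_summable_imp_summable_on) simp
    then show "(\<lambda>j. norm (b j) * u j) summable_on UNIV"
      by (rule summable_on_comparison_test) (auto intro!: mult_left_mono u mult_nonneg_nonneg u0)
  qed (auto intro!: mult_nonneg_nonneg pos)
  have "\<exists>s'\<le>infsum ?t (UNIV \<times> UNIV). power_series_bound (\<lambda>x. g (f x)) a r s'"
  proof (rule power_series_boundI[OF r has_sum_infsum[OF sum]])
    fix x assume x: "x \<in> ball a r"
    then have n: "norm (x - a) \<le> r" by (simp add: dist_norm norm_minus_commute)
    \<comment> \<open>The weighted norm bounds the values of \<open>f\<close> on the ball, so the
      expansion of \<open>g\<close> applies to each of them.\<close>
    have fx: "norm (f x) \<le> s" by (rule power_series_bound_norm_le[OF f x])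
    show "((\<lambda>p. ?e p * of_real (monomial (snd p) (x - a))) has_sum g (f x)) (UNIV \<times> UNIV)"
    proof (rule has_sum_SigmaI)
      show "((\<lambda>k. ?e (j, k) * of_real (monomial (snd (j, k)) (x - a))) has_sum b j * f x ^ j) UNIV" for j
        using has_sum_cmult_right[OF fj[OF x, of j], of "b j"] by (simp add: mult_ac)
      have "summable (\<lambda>j. norm (b j * f x ^ j))"
        by (rule summable_comparison_test'[OF b, of 0])
          (auto simp: norm_mult norm_power intro!: mult_left_mono power_mono fx)
      then show "((\<lambda>j. b j * f x ^ j) has_sum g (f x)) UNIV"
        by (rule norm_summable_imp_has_sum[OF _ g[OF fx]])
      show "(\<lambda>p. ?e p * of_real (monomial (snd p) (x - a))) summable_on UNIV \<times> UNIV"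
        by (rule abs_summable_summable[OF abs_summable_on_monomials[OF sum n]])
    qed
  qed
  then show ?thesis by blast
qed

text \<open>With \<open>f a = 0\<close> there is no constant term, and every other term gains a
  factor \<open>u\<close>. Thus a smaller radius makes the norm as small as desired, as composition
  with a function holomorphic on a given disc requires.\<close>

lemma power_series_bound_shrink:
  assumes "power_series_bound f a r s" "f a = 0" "0 < u" "u \<le> 1"
  shows "\<exists>s'\<le>u * s. power_series_bound f a (u * r) s'"
proof -
  from assms(1) obtain c where r: "r > 0"
    and c: "((\<lambda>k. norm (c k) * monomial k (vec r)) has_sum s) UNIV"
    and f: "\<And>x. x \<in> ball a r \<Longrightarrow> ((\<lambda>k. c k * of_real (monomial k (x - a))) has_sum f x) UNIV"
    unfolding power_series_bound_def by blast
  \<comment> \<open>At the centre only the constant monomial survives, so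
    \<open>c 0 = f a\<close>.\<close>
  have "((\<lambda>k. c k * of_real (monomial k (a - a))) has_sum c 0) UNIV"
    by (rule has_sum_finite_neutralI[of "{0}"]) (auto simp: monomial_at_0)
  with f[of a] r have c0: "c 0 = 0" using has_sum_unique assms(2) by fastforce
  have le: "norm (c k) * monomial k (vec (u * r)) \<le> u * (norm (c k) * monomial k (vec r))" for k
  proof (cases "k = 0")
    case False
    then have "norm (c k) * monomial k (vec (u * r)) \<le> norm (c k) * (u * monomial k (vec r))"
      using assms r by (intro mult_left_mono monomial_vec_scale_le) auto
    then show ?thesis by (simp add: mult_ac)
  qed (simp add: c0)
  have us: "((\<lambda>k. u * (norm (c k) * monomial k (vec r))) has_sum u * s) UNIV"
    by (rule has_sum_cmult_right[OF c])
  have sm: "(\<lambda>k. norm (c k) * monomial k (vec (u * r))) summable_on UNIV"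
    by (rule summable_on_comparison_test[OF has_sum_imp_summable[OF us]])
      (use le assms r in \<open>auto intro!: mult_nonneg_nonneg less_imp_le[OF monomial_vec_pos]\<close>)
  have "power_series_bound f a (u * r) (\<Sum>\<^sub>\<infinity>k. norm (c k) * monomial k (vec (u * r)))"
    unfolding power_series_bound_def
  proof (intro conjI exI ballI)
    fix x assume "x \<in> ball a (u * r)"
    moreover have "u * r \<le> 1 * r" using assms r by (intro mult_right_mono) auto
    ultimately show "((\<lambda>k. c k * of_real (monomial k (x - a))) has_sum f x) UNIV"
      by (intro f) auto
  qed (use assms r sm in auto)
  moreover have "(\<Sum>\<^sub>\<infinity>k. norm (c k) * monomial k (vec (u * r))) \<le> u * s"
    by (rule has_sum_mono[OF has_sum_infsum[OF sm] us]) (use le in auto)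
  ultimately show ?thesis by blast
qed

lemma power_series_bound_add:
  assumes "power_series_bound f a r s" "power_series_bound g a r t"
  shows "\<exists>u. power_series_bound (\<lambda>x. f x + g x) a r u"
proof -
  from assms(1) obtain c where r: "r > 0"
    and c: "((\<lambda>k. norm (c k) * monomial k (vec r)) has_sum s) UNIV"
    and f: "\<And>x. x \<in> ball a r \<Longrightarrow> ((\<lambda>k. c k * of_real (monomial k (x - a))) has_sum f x) UNIV"
    unfolding power_series_bound_def by blast
  from assms(2) obtain d where
        d: "((\<lambda>k. norm (d k) * monomial k (vec r)) has_sum t) UNIV"
    and g: "\<And>x. x \<in> ball a r \<Longrightarrow> ((\<lambda>k. d k * of_real (monomial k (x - a))) has_sum g x) UNIV"
    unfolding power_series_bound_def by blast
  have pos: "0 \<le> monomial k (vec r)" for k :: "nat ^ 'a" using monomial_vec_pos[OF r, of k] by simp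
  have "(\<lambda>k. norm (c k) * monomial k (vec r) + norm (d k) * monomial k (vec r)) summable_on UNIV"
    by (rule has_sum_imp_summable[OF has_sum_add[OF c d]])
  then have sm: "(\<lambda>k. norm (c k + d k) * monomial k (vec r)) summable_on UNIV"
    by (rule summable_on_comparison_test)
      (auto simp: distrib_right[symmetric] intro!: mult_right_mono norm_triangle_ineq pos mult_nonneg_nonneg)
  show ?thesis
    unfolding power_series_bound_def
  proof (intro exI[of _ "\<Sum>\<^sub>\<infinity>k. norm (c k + d k) * monomial k (vec r)"]
      exI[of _ "\<lambda>k. c k + d k"] conjI ballI has_sum_infsum[OF sm])
    show "((\<lambda>k. (c k + d k) * of_real (monomial k (x - a))) has_sum f x + g x) UNIV"
      if "x \<in> ball a r" for x
      using has_sum_add[OF f[OF that] g[OF that]] by (simp add: distrib_right)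
  qed (fact r)
qed

section \<open>Analyticity at a point and its closure properties\<close>

definition analytic_at :: "(real ^ 'n \<Rightarrow> complex) \<Rightarrow> real ^ 'n \<Rightarrow> bool"
  where "analytic_at f a \<longleftrightarrow> (\<exists>r s. power_series_bound f a r s)"

lemma analytic_at_const: "analytic_at (\<lambda>x. w) a"
  unfolding analytic_at_def using power_series_bound_const[of 1 w a] by auto

lemma power_series_bound_mono:
  assumes "power_series_bound f a r s" "0 < r'" "r' \<le> r"
  shows "\<exists>s'. power_series_bound f a r' s'"
proof -
  from assms(1) obtain c where r: "r > 0"
    and c: "((\<lambda>k. norm (c k) * monomial k (vec r)) has_sum s) UNIV"
    and f: "\<And>x. x \<in> ball a r \<Longrightarrow> ((\<lambda>k. c k * of_real (monomial k (x - a))) has_sum f x) UNIV"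
    unfolding power_series_bound_def by blast
  have "monomial k (vec r') \<le> monomial k (vec r)" for k :: "nat ^ 'a"
    unfolding monomial_def using assms by (intro prod_mono) (auto intro: power_mono)
  then have sm: "(\<lambda>k. norm (c k) * monomial k (vec r')) summable_on UNIV"
    by (intro summable_on_comparison_test[OF has_sum_imp_summable[OF c]])
      (use assms in \<open>auto intro!: mult_nonneg_nonneg mult_left_mono less_imp_le[OF monomial_vec_pos]\<close>)
  show ?thesis
    unfolding power_series_bound_def
    by (intro exI[of _ "\<Sum>\<^sub>\<infinity>k. norm (c k) * monomial k (vec r')"] exI[of _ c] conjI ballI f has_sum_infsum[OF sm])
      (use assms in auto)
qed

lemma analytic_at_common_radius:
  assumes "analytic_at f a" "analytic_at g a"
  obtains r s t where "power_series_bound f a r s" "power_series_bound g a r t"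
proof -
  from assms obtain r1 s1 r2 s2
    where *: "power_series_bound f a r1 s1" "power_series_bound g a r2 s2"
    unfolding analytic_at_def by blast
  then have "r1 > 0" "r2 > 0" by (auto simp: power_series_bound_def)
  then show thesis
    using power_series_bound_mono[OF *(1), of "min r1 r2"] power_series_bound_mono[OF *(2), of "min r1 r2"] that
    by auto
qed

lemma analytic_at_add:
  assumes "analytic_at f a" "analytic_at g a"
  shows "analytic_at (\<lambda>x. f x + g x) a"
proof -
  obtain r s t where "power_series_bound f a r s" "power_series_bound g a r t"
    using analytic_at_common_radius[OF assms] .
  from power_series_bound_add[OF this] show ?thesis unfolding analytic_at_def by blast
qed

lemma analytic_at_mult:
  assumes "analytic_at f a" "analytic_at g a"
  shows "analytic_at (\<lambda>x. f x * g x) a"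
proof -
  obtain r s t where "power_series_bound f a r s" "power_series_bound g a r t"
    using analytic_at_common_radius[OF assms] .
  from power_series_bound_mult[OF this] show ?thesis unfolding analytic_at_def by blast
qed

lemma analytic_at_diff:
  assumes "analytic_at f a" "analytic_at g a"
  shows "analytic_at (\<lambda>x. f x - g x) a"
  using analytic_at_add[OF assms(1) analytic_at_mult[OF analytic_at_const assms(2), of "- 1"]] by simp

lemma analytic_at_component:
  fixes a :: "real ^ 'n"
  shows "analytic_at (\<lambda>x. of_real (x $ i)) a"
proof -
  let ?c = "\<lambda>k :: nat ^ 'n. if k = axis i 1 then 1 else 0 :: complex"
  have "power_series_bound (\<lambda>x. of_real ((x - a) $ i)) a 1 1"
    unfolding power_series_bound_def
  proof (intro conjI exI[of _ ?c] ballI)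
    show "((\<lambda>k. norm (?c k) * monomial k (vec 1)) has_sum 1) UNIV"
      by (rule has_sum_finite_neutralI[of "{axis i 1}"]) (auto simp del: One_nat_def)
    show "((\<lambda>k. ?c k * of_real (monomial k (x - a))) has_sum of_real ((x - a) $ i)) UNIV" for x
      by (rule has_sum_finite_neutralI[of "{axis i 1}"]) (auto simp del: One_nat_def)
  qed simp
  then have "analytic_at (\<lambda>x. of_real ((x - a) $ i)) a" unfolding analytic_at_def by blast
  from analytic_at_add[OF this analytic_at_const[of "of_real (a $ i)"]] show ?thesis by simp
qed

text \<open>After subtracting \<open>f a\<close>, shrinking brings the norm below \<open>R\<close>;
  the Taylor series of \<open>g\<close> at \<open>f a\<close> can then be substituted.\<close>

lemma analytic_at_compose:
  assumes f: "analytic_at f a" and g: "g holomorphic_on ball (f a) R" and "R > 0"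
  shows "analytic_at (\<lambda>x. g (f x)) a"
proof -
  define h where "h x = f x - f a" for x
  have "analytic_at h a" unfolding h_def using f by (rule analytic_at_diff[OF _ analytic_at_const])
  then obtain r s where rs: "power_series_bound h a r s" unfolding analytic_at_def by blast
  have s: "s \<ge> 0" by (rule power_series_bound_nonneg[OF rs])
  \<comment> \<open>The summand 1 keeps the denominator positive even for \<open>s = 0\<close>; the
    choice ensures \<open>u * s < R\<close>.\<close>
  define u where "u = min 1 (R / (2 * (s + 1)))"
  have u: "0 < u" "u \<le> 1" using s \<open>R > 0\<close> by (auto simp: u_def)
  have "u * s \<le> R / (2 * (s + 1)) * s" using s by (intro mult_right_mono) (auto simp: u_def)
  also have "\<dots> < R" using s \<open>R > 0\<close> by (simp add: field_simps add_nonneg_pos)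
  finally have "u * s < R" .
  with power_series_bound_shrink[OF rs _ u] obtain s' where s': "s' < R" "power_series_bound h a (u * r) s'"
    unfolding h_def by (meson diff_self le_less_trans)
  have s'0: "s' \<ge> 0" by (rule power_series_bound_nonneg[OF s'(2)])
  define b where "b j = (deriv ^^ j) g (f a) / fact j" for j
  have g': "(\<lambda>j. b j * w ^ j) sums g (f a + w)" if "norm w < R" for w
    using holomorphic_power_series[OF g, of "f a + w"] that by (simp add: b_def dist_norm)
  \<comment> \<open>Convergence at a radius strictly between \<open>s'\<close> and \<open>R\<close>
    yields absolute convergence at \<open>s'\<close>.\<close>
  obtain R' where R': "s' < R'" "R' < R" using dense s'(1) by blast
  have "summable (\<lambda>j. b j * of_real R' ^ j)"
    using g'[of "of_real R'"] R' s'0 by (auto simp: sums_iff)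
  from powser_insidea[OF this, of "of_real s'"] R' s'0
  have "summable (\<lambda>j. norm (b j) * s' ^ j)" by (simp add: norm_mult norm_power)
  from power_series_bound_compose[OF s'(2) this, of "\<lambda>w. g (f a + w)"] g' s'(1)
  show ?thesis unfolding analytic_at_def h_def by auto
qed

lemma analytic_at_divide:
  assumes "analytic_at f a" "analytic_at g a" "g a \<noteq> 0"
  shows "analytic_at (\<lambda>x. f x / g x) a"
proof -
  \<comment> \<open>This is the largest disc around \<open>g a\<close> that avoids 0.\<close>
  have "(\<lambda>w. inverse w) holomorphic_on ball (g a) (norm (g a))"
    by (intro holomorphic_intros) (auto simp: dist_norm)
  from analytic_at_compose[OF assms(2) this] assms(3) have "analytic_at (\<lambda>x. inverse (g x)) a" by simp
  from analytic_at_mult[OF assms(1) this] show ?thesis by (simp add: divide_inverse)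
qed

lemma analytic_at_Ln:
  assumes "analytic_at f a" "f a \<notin> \<real>\<^sub>\<le>\<^sub>0"
  shows "analytic_at (\<lambda>x. Ln (f x)) a"
proof -
  have "open (- \<real>\<^sub>\<le>\<^sub>0 :: complex set)" by auto
  then obtain R where R: "R > 0" "ball (f a) R \<subseteq> - \<real>\<^sub>\<le>\<^sub>0"
    using assms(2) by (meson ComplI open_contains_ball)
  then have "Ln holomorphic_on ball (f a) R" by (intro holomorphic_intros) auto
  with R(1) show ?thesis by (intro analytic_at_compose[OF assms(1)])
qed

section \<open>Real and imaginary parts, and partial derivatives\<close>

text \<open>Monomials are real, so the real parts of the coefficients expand the real part of the
  function.\<close>

lemma real_analytic_on_Re:
  assumes "\<And>a. a \<in> S \<Longrightarrow> analytic_at f a"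
  shows "real_analytic_on (\<lambda>x. Re (f x)) S"
  unfolding real_analytic_on_def
proof
  fix a assume "a \<in> S"
  then obtain r c where r: "r > 0"
    and f: "\<And>x. x \<in> ball a r \<Longrightarrow> ((\<lambda>k. c k * of_real (monomial k (x - a))) has_sum f x) UNIV"
    using assms unfolding analytic_at_def power_series_bound_def by blast
  have "((\<lambda>k. Re (c k) * (\<Prod>i\<in>UNIV. (x $ i - a $ i) ^ (k $ i))) has_sum Re (f x)) UNIV"
    if "x \<in> ball a r" for x
    using has_sum_Re[OF f[OF that]] by (simp del: of_real_diff of_real_mult of_real_prod of_real_power add: monomial_def)
  then show "\<exists>r>0. \<exists>c. \<forall>x\<in>ball a r.
      ((\<lambda>k. c k * (\<Prod>i\<in>UNIV. (x $ i - a $ i) ^ (k $ i))) has_sum Re (f x)) UNIV"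
    by (intro exI[of _ r] conjI r exI[of _ "\<lambda>k. Re (c k)"] ballI)
qed

lemma real_analytic_on_Im:
  assumes "\<And>a. a \<in> S \<Longrightarrow> analytic_at f a"
  shows "real_analytic_on (\<lambda>x. - Im (f x)) S"
proof -
  have "real_analytic_on (\<lambda>x. Re (\<i> * f x)) S"
    by (intro real_analytic_on_Re analytic_at_mult analytic_at_const assms)
  then show ?thesis by simp
qed

lemma partial_derivs_has_derivative:
  assumes "(f has_derivative f') (at x)"
  shows "partial_derivs f x = (\<chi> j. f' (axis j 1))"
proof -
  interpret f': bounded_linear f' using assms by (rule has_derivative_bounded_linear)
  have "((\<lambda>t. f (x + t *\<^sub>R axis j 1)) has_real_derivative f' (axis j 1)) (at 0)" for j
  proof -
    have "((\<lambda>t. x + t *\<^sub>R axis j 1) has_derivative (\<lambda>t. t *\<^sub>R axis j 1)) (at (0::real))"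
      by (auto intro!: derivative_eq_intros)
    from has_derivative_compose[OF this, of f f'] assms show ?thesis
      by (simp add: has_field_derivative_def f'.scaleR mult.commute[of _ "f' _"])
  qed
  then show ?thesis by (simp add: partial_derivs_def vec_eq_iff DERIV_imp_deriv)
qed

text \<open>A full derivative, with the complex partial derivatives as entries of \<open>D\<close>,
  so that the chain rule for \<open>Ln\<close> applies.\<close>

definition has_gradient :: "(real ^ 'n \<Rightarrow> complex) \<Rightarrow> complex ^ 'n \<Rightarrow> real ^ 'n \<Rightarrow> bool"
  where "has_gradient f D x \<longleftrightarrow> (f has_derivative (\<lambda>v. \<Sum>j\<in>UNIV. of_real (v $ j) * D $ j)) (at x)"

text \<open>The constant \<open>w\<close> cancels in the logarithmic derivative; it only rotates the
  values of \<open>f\<close> off the branch cut.\<close>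

lemma partial_derivs_Ln:
  assumes "has_gradient f D x" and "w * f x \<notin> \<real>\<^sub>\<le>\<^sub>0"
  shows "partial_derivs (\<lambda>x. Re (Ln (w * f x))) x = (\<chi> j. Re (D $ j / f x))"
    and "partial_derivs (\<lambda>x. - Im (Ln (w * f x))) x = (\<chi> j. - Im (D $ j / f x))"
proof -
  have nz: "w \<noteq> 0" "f x \<noteq> 0" using assms(2) by auto
  have "((\<lambda>x. w * f x) has_derivative (\<lambda>v. w * (\<Sum>j\<in>UNIV. of_real (v $ j) * D $ j))) (at x)"
    using assms(1) unfolding has_gradient_def by (rule has_derivative_mult_right)
  moreover have "(Ln has_derivative (\<lambda>v. inverse (w * f x) * v)) (at (w * f x))"
    using has_field_derivative_Ln[OF assms(2)] by (simp add: has_field_derivative_def)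
  ultimately have "((\<lambda>x. Ln (w * f x)) has_derivative
      (\<lambda>v. inverse (w * f x) * (w * (\<Sum>j\<in>UNIV. of_real (v $ j) * D $ j)))) (at x)"
    by (rule has_derivative_compose)
  then have L: "((\<lambda>x. Ln (w * f x)) has_derivative (\<lambda>v. (\<Sum>j\<in>UNIV. of_real (v $ j) * D $ j) / f x)) (at x)"
    using nz by (simp add: field_simps)
  have ax: "(\<Sum>i\<in>UNIV. complex_of_real (axis j 1 $ i) * D $ i) = D $ j" for j
  proof -
    have "(\<Sum>i\<in>UNIV. complex_of_real (axis j 1 $ i) * D $ i) = (\<Sum>i\<in>UNIV. if i = j then D $ i else 0)"
      by (rule sum.cong) (auto simp: axis_def)
    then show ?thesis by simp
  qed
  show "partial_derivs (\<lambda>x. Re (Ln (w * f x))) x = (\<chi> j. Re (D $ j / f x))"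
    using partial_derivs_has_derivative[OF has_derivative_Re[OF L]] by (simp only: ax)
  show "partial_derivs (\<lambda>x. - Im (Ln (w * f x))) x = (\<chi> j. - Im (D $ j / f x))"
    using partial_derivs_has_derivative[OF has_derivative_minus[OF has_derivative_Im[OF L]]] by (simp only: ax)
qed

section \<open>Complex form of the system\<close>

text \<open>The two real equations are the real and imaginary parts of one complex equation; for
  \<open>c = d = 0\<close> they are the Cauchy-Riemann equations. Both halves of the system have
  this shape.\<close>

lemma cauchy_riemann_iff:
  fixes c d A3 A4 B3 B4 :: real
  assumes "cos c > 0"
  shows "- B3 = A4 * exp (- d) / cos c - A3 * tan c \<and> B4 = A3 * exp d / cos c - A4 * tan c
    \<longleftrightarrow> Complex B4 (- A4) = \<i> * exp (Complex d (- c)) * Complex B3 (- A3)"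
    (is "?R \<longleftrightarrow> ?C")
proof -
  have *: "?C \<longleftrightarrow> B4 = exp d * (sin c * B3 + cos c * A3) \<and> A4 = exp d * (sin c * A3 - cos c * B3)"
    by (auto simp: complex_eq_iff Re_exp Im_exp algebra_simps)
  have "- B3 = A4 * exp (- d) / cos c - A3 * tan c \<longleftrightarrow> A4 = exp d * (sin c * A3 - cos c * B3)"
    using assms by (auto simp: tan_def exp_minus field_simps)
  \<comment> \<open>The second equations match only once \<open>A4\<close> is substituted from the
    first; \<open>1 - (sin c)\<^sup>2\<close> then cancels the division by
    \<open>cos c\<close>.\<close>
  moreover have "B4 = A3 * exp d / cos c - A4 * tan c \<longleftrightarrow> B4 = exp d * (sin c * B3 + cos c * A3)"
    if "A4 = exp d * (sin c * A3 - cos c * B3)"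
  proof -
    have "A3 * exp d / cos c - A4 * tan c = exp d * (sin c * B3 + (1 - (sin c)\<^sup>2) / cos c * A3)"
      using assms by (simp add: that tan_def field_simps power2_eq_square)
    also have "(1 - (sin c)\<^sup>2) / cos c = cos c"
      using assms by (simp add: cos_squared_eq[symmetric]) (simp add: power2_eq_square)
    finally show ?thesis by simp
  qed
  ultimately show ?thesis unfolding * by blast
qed

lemma pde_relation_complex:
  assumes "cos a > 0" "cos c > 0"
  shows "pde_relation a b c d A B C D \<longleftrightarrow>
    Complex (B $ 4) (- A $ 4) = \<i> * exp (Complex d (- c)) * Complex (B $ 3) (- A $ 3) \<and>
    Complex (D $ 2) (- C $ 2) = \<i> * exp (Complex b (- a)) * Complex (D $ 1) (- C $ 1)"
  unfolding pde_relation_explicit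
  using cauchy_riemann_iff[OF assms(2), of "B $ 3" "A $ 4" d "A $ 3" "B $ 4"]
    cauchy_riemann_iff[OF assms(1), of "D $ 1" "C $ 2" b "C $ 1" "D $ 2"]
  by auto

text \<open>The coordinate labels are parameters because exchanging \<open>P\<close> with
  \<open>Q\<close> and the first two labels with the last two is a symmetry, which later halves the
  case analysis.\<close>

definition pair_solution_at ::
    "4 \<Rightarrow> 4 \<Rightarrow> 4 \<Rightarrow> 4 \<Rightarrow> (real ^ 4 \<Rightarrow> complex) \<Rightarrow> (real ^ 4 \<Rightarrow> complex) \<Rightarrow>
      (real ^ 4 \<Rightarrow> complex ^ 4) \<Rightarrow> (real ^ 4 \<Rightarrow> complex ^ 4) \<Rightarrow> real ^ 4 \<Rightarrow> bool"
  where "pair_solution_at i1 i2 i3 i4 P Q DP DQ x \<longleftrightarrow>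
    analytic_at P x \<and> analytic_at Q x \<and> has_gradient P (DP x) x \<and> has_gradient Q (DQ x) x \<and>
    DP x $ i2 = Q x * DP x $ i1 \<and> DQ x $ i4 = P x * DQ x $ i3"

lemma pair_solution_swap:
  "pair_solution_at i1 i2 i3 i4 P Q DP DQ x \<longleftrightarrow> pair_solution_at i3 i4 i1 i2 Q P DQ DP x"
  unfolding pair_solution_at_def by blast

text \<open>Near \<open>z\<close> the principal logarithm inverts the substitution
  \<open>P = \<i> * exp Z\<close>, \<open>Q = \<i> * exp W\<close>, since positivity of both
  imaginary parts is an open condition.\<close>

lemma solution_from_pair:
  assumes ev: "\<forall>\<^sub>F x in nhds z. pair_solution_at 1 2 3 4 P Q DP DQ x"
    and Pz: "P z = \<i> * exp (Complex d (- c))" and Qz: "Q z = \<i> * exp (Complex b (- a))"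
    and DP: "DP z = (\<chi> j. P z * Complex (D $ j) (- C $ j))"
    and DQ: "DQ z = (\<chi> j. Q z * Complex (B $ j) (- A $ j))"
    and a: "a \<in> {- pi/2 <..< pi/2}" and c: "c \<in> {- pi/2 <..< pi/2}"
  shows "\<exists>U \<alpha> \<beta> \<gamma> \<delta>. open U \<and> z \<in> U \<and>
    real_analytic_on \<alpha> U \<and> real_analytic_on \<beta> U \<and>
    real_analytic_on \<gamma> U \<and> real_analytic_on \<delta> U \<and>
    is_solution_on \<alpha> \<beta> \<gamma> \<delta> U \<and>
    \<alpha> z = a \<and> \<beta> z = b \<and> \<gamma> z = c \<and> \<delta> z = d \<and>
    partial_derivs \<alpha> z = A \<and> partial_derivs \<beta> z = B \<and>
    partial_derivs \<gamma> z = C \<and> partial_derivs \<delta> z = D"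
proof -
  have cosa: "cos a > 0" and cosc: "cos c > 0" using a c by (auto intro!: cos_gt_zero_pi)
  have "pair_solution_at 1 2 3 4 P Q DP DQ z" using ev by (rule eventually_nhds_x_imp_x)
  then have "isCont P z" "isCont Q z"
    unfolding pair_solution_at_def has_gradient_def by (auto dest: has_derivative_continuous)
  then have "((\<lambda>x. Im (P x)) \<longlongrightarrow> Im (P z)) (nhds z)" "((\<lambda>x. Im (Q x)) \<longlongrightarrow> Im (Q z)) (nhds z)"
    by (auto intro!: tendsto_Im simp: continuous_at isCont_def tendsto_at_iff_tendsto_nhds)
  moreover have "Im (P z) > 0" "Im (Q z) > 0"
    using cosa cosc by (auto simp: Pz Qz Re_exp)
  ultimately have "\<forall>\<^sub>F x in nhds z. pair_solution_at 1 2 3 4 P Q DP DQ x \<and> Im (P x) > 0 \<and> Im (Q x) > 0"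
    using ev by (auto intro!: eventually_conj order_tendstoD)
  then obtain U where U: "open U" "z \<in> U"
    and sol: "\<And>x. x \<in> U \<Longrightarrow> pair_solution_at 1 2 3 4 P Q DP DQ x"
    and pos: "\<And>x. x \<in> U \<Longrightarrow> Im (P x) > 0" "\<And>x. x \<in> U \<Longrightarrow> Im (Q x) > 0"
    unfolding eventually_nhds by blast
  \<comment> \<open>On \<open>U\<close> the numbers \<open>- \<i> * Q x\<close> and
    \<open>- \<i> * P x\<close> lie in the right half plane, so \<open>Ln\<close> is holomorphic
    there and the imaginary parts of \<open>W\<close> and \<open>Z\<close> stay between -pi/2 and
    pi/2.\<close>
  define W where "W x = Ln (- \<i> * Q x)" for x
  define Z where "Z x = Ln (- \<i> * P x)" for x
  have np: "- \<i> * P x \<notin> \<real>\<^sub>\<le>\<^sub>0" "- \<i> * Q x \<notin> \<real>\<^sub>\<le>\<^sub>0" if "x \<in> U" for x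
    using pos[OF that] by (auto simp: complex_nonpos_Reals_iff)
  have expW: "\<i> * exp (W x) = Q x" and expZ: "\<i> * exp (Z x) = P x" if "x \<in> U" for x
    using pos[OF that] by (auto simp: W_def Z_def exp_Ln complex_eq_iff)
  have ImW: "\<bar>Im (W x)\<bar> < pi / 2" and ImZ: "\<bar>Im (Z x)\<bar> < pi / 2" if "x \<in> U" for x
    using pos[OF that] Re_Ln_pos_lt[of "- \<i> * P x"] Re_Ln_pos_lt[of "- \<i> * Q x"]
    by (force simp: W_def Z_def)+
  have an: "analytic_at W x" "analytic_at Z x" if "x \<in> U" for x
    unfolding W_def Z_def using sol[OF that]
    by (intro analytic_at_Ln analytic_at_mult analytic_at_const np that; simp add: pair_solution_at_def)+
  have grad: "has_gradient P (DP x) x" "has_gradient Q (DQ x) x" if "x \<in> U" for x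
    using sol[OF that] by (auto simp: pair_solution_at_def)
  note pd = partial_derivs_Ln[OF grad(1) np(1), folded Z_def] partial_derivs_Ln[OF grad(2) np(2), folded W_def]
  \<comment> \<open>The ranges of \<open>a\<close> and \<open>c\<close> put the prescribed exponents
    in the principal strip, so \<open>Ln\<close> recovers them exactly.\<close>
  have Wz: "W z = Complex b (- a)" and Zz: "Z z = Complex d (- c)"
    using a c by (auto simp: W_def Z_def Qz Pz mult.assoc[symmetric] intro!: Ln_exp)
  have nz: "P z \<noteq> 0" "Q z \<noteq> 0" by (auto simp: Pz Qz)
  show ?thesis
  proof (rule exI[of _ U], rule exI[of _ "\<lambda>x. - Im (W x)"], rule exI[of _ "\<lambda>x. Re (W x)"],
      rule exI[of _ "\<lambda>x. - Im (Z x)"], rule exI[of _ "\<lambda>x. Re (Z x)"], intro conjI)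
    show "real_analytic_on (\<lambda>x. - Im (W x)) U" "real_analytic_on (\<lambda>x. - Im (Z x)) U"
      "real_analytic_on (\<lambda>x. Re (W x)) U" "real_analytic_on (\<lambda>x. Re (Z x)) U"
      by (intro real_analytic_on_Re real_analytic_on_Im an; assumption)+
    show "is_solution_on (\<lambda>x. - Im (W x)) (\<lambda>x. Re (W x)) (\<lambda>x. - Im (Z x)) (\<lambda>x. Re (Z x)) U"
      unfolding is_solution_on_def
    proof (intro ballI conjI)
      fix x assume x: "x \<in> U"
      show rW: "- Im (W x) \<in> {- pi/2 <..< pi/2}" and rZ: "- Im (Z x) \<in> {- pi/2 <..< pi/2}"
        using ImW[OF x] ImZ[OF x] by auto
      have cos: "cos (- Im (W x)) > 0" "cos (- Im (Z x)) > 0"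
        using rW rZ by (auto simp del: cos_minus intro!: cos_gt_zero_pi)
      show "pde_relation (- Im (W x)) (Re (W x)) (- Im (Z x)) (Re (Z x))
         (partial_derivs (\<lambda>x. - Im (W x)) x) (partial_derivs (\<lambda>x. Re (W x)) x)
         (partial_derivs (\<lambda>x. - Im (Z x)) x) (partial_derivs (\<lambda>x. Re (Z x)) x)"
        \<comment> \<open>The partial derivatives of \<open>Z\<close> and \<open>W\<close> are those
          of \<open>P\<close> and \<open>Q\<close> divided by \<open>P\<close> and \<open>Q\<close>;
          dividing the pair equations likewise gives the complex form.\<close>
        unfolding pde_relation_complex[OF cos] pd[OF x x]
        using sol[OF x] expW[OF x] expZ[OF x] by (auto simp: pair_solution_at_def)
    qed
  qed (use U Wz Zz pd[OF U(2) U(2)] nz in \<open>simp_all add: DP DQ vec_eq_iff\<close>)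
qed

section \<open>Explicit solutions of the complex pair of equations\<close>

lemma sum_UNIV_4:
  fixes i1 i2 i3 i4 :: 4
  assumes "distinct [i1, i2, i3, i4]"
  shows "sum f UNIV = f i1 + f i2 + f i3 + f i4"
proof -
  have "{i1, i2, i3, i4} = UNIV"
    by (rule card_subset_eq) (use assms in auto)
  then have "sum f UNIV = sum f {i1, i2, i3, i4}" by simp
  also have "\<dots> = f i1 + f i2 + f i3 + f i4" using assms by (simp add: add.assoc)
  finally show ?thesis .
qed

lemma vec_eq_iff_4:
  fixes i1 i2 i3 i4 :: 4
  assumes "distinct [i1, i2, i3, i4]"
  shows "u = v \<longleftrightarrow> u $ i1 = v $ i1 \<and> u $ i2 = v $ i2 \<and> u $ i3 = v $ i3 \<and> u $ i4 = v $ i4"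
proof -
  have "UNIV = {i1, i2, i3, i4}"
    by (rule card_subset_eq[symmetric]) (use assms in auto)
  then have "(\<forall>i. R i) \<longleftrightarrow> R i1 \<and> R i2 \<and> R i3 \<and> R i4" for R
    by (metis UNIV_I insert_iff singletonD)
  then show ?thesis by (simp add: vec_eq_iff)
qed

lemma has_derivative_coordinate:
  "((\<lambda>x. complex_of_real (x $ i - w)) has_derivative (\<lambda>v. of_real (v $ i))) (at x)"
  by (intro has_derivative_of_real) (auto intro!: derivative_eq_intros bounded_linear_imp_has_derivative)

lemma analytic_at_coordinate: "analytic_at (\<lambda>x. of_real (x $ i - w)) a"
  using analytic_at_diff[OF analytic_at_component analytic_at_const, of i "of_real w"] by simp

text \<open>\<open>P\<close> varies only with the coordinates \<open>i3\<close>, \<open>i4\<close>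
  and \<open>Q\<close> only with \<open>i1\<close>, \<open>i2\<close>, so both sides of each
  equation vanish.\<close>

lemma affine_pair_solution:
  fixes z :: "real ^ 4" and p q :: "complex ^ 4"
  assumes dist: "distinct [i1, i2, i3, i4]"
    and zero: "p $ i1 = 0" "p $ i2 = 0" "q $ i3 = 0" "q $ i4 = 0"
  obtains P Q DP DQ where "\<forall>\<^sub>F x in nhds z. pair_solution_at i1 i2 i3 i4 P Q DP DQ x"
    "P z = p0" "Q z = q0" "DP z = p" "DQ z = q"
proof
  define P where "P x = p0 + of_real (x $ i3 - z $ i3) * p $ i3 + of_real (x $ i4 - z $ i4) * p $ i4" for x
  define Q where "Q x = q0 + of_real (x $ i1 - z $ i1) * q $ i1 + of_real (x $ i2 - z $ i2) * q $ i2" for x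
  have "has_gradient P p x" "has_gradient Q q x" for x
    unfolding has_gradient_def sum_UNIV_4[OF dist] zero P_def Q_def
    by (rule has_derivative_coordinate derivative_eq_intros refl ext | simp)+
  moreover have "analytic_at P x" "analytic_at Q x" for x
    unfolding P_def Q_def
    by (intro analytic_at_add analytic_at_mult analytic_at_const analytic_at_coordinate)+
  ultimately show "\<forall>\<^sub>F x in nhds z. pair_solution_at i1 i2 i3 i4 P Q (\<lambda>_. p) (\<lambda>_. q) x"
    by (simp add: pair_solution_at_def zero)
  show "P z = p0" "Q z = q0" by (simp_all add: P_def Q_def)
qed auto

text \<open>Solving \<open>P = P(x)\<close> for \<open>x\<^sup>1 = X(P, x\<^sup>2, x\<^sup>3, x\<^sup>4)\<close> gives \<open>Q = - X\<^sub>2\<close>, and the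
  equations reduce to \<open>X\<^sub>4 - P X\<^sub>3 = g X\<^sub>P\<close> with \<open>g\<close> independent of \<open>x\<^sup>2\<close>. For constant
  \<open>g = 2 G\<close> the characteristics have the invariants \<open>u = P + 2 G x\<^sup>4\<close> and
  \<open>v = x\<^sup>3 + P x\<^sup>4 + G (x\<^sup>4)\<^sup>2\<close>, so \<open>X\<close> is an arbitrary function of \<open>x\<^sup>2, u, v\<close>. The solution
  below is \<open>X = - q0 x\<^sup>2 + e (x\<^sup>2)\<^sup>2 + (k + m x\<^sup>2) (u - p0) + (l + n x\<^sup>2) v\<close>, which is affine
  in \<open>P = p0 + y\<close>.\<close>

lemma rational_pair_solution:
  fixes z :: "real ^ 4" and p q :: "complex ^ 4"
  assumes dist: "distinct [i1, i2, i3, i4]"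
    and p2: "p $ i2 = q0 * p $ i1" and q4: "q $ i4 = p0 * q $ i3" and p1: "p $ i1 \<noteq> 0"
  obtains P Q DP DQ where "\<forall>\<^sub>F x in nhds z. pair_solution_at i1 i2 i3 i4 P Q DP DQ x"
    "P z = p0" "Q z = q0" "DP z = p" "DQ z = q"
proof
  \<comment> \<open>The six constants are found by evaluating the gradient formulas for
    \<open>DP\<close> and \<open>DQ\<close> at \<open>z\<close> and solving for the prescribed jet:
    \<open>k\<close>, \<open>l\<close>, \<open>G\<close> match \<open>p\<close>, and
    \<open>m\<close>, \<open>e\<close>, \<open>n\<close> match \<open>q\<close>.\<close>
  define k where "k = 1 / p $ i1"
  define l where "l = - k * p $ i3"
  define G where "G = (p0 * p $ i3 - p $ i4) / 2"
  define m where "m = - k * q $ i1"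
  define e where "e = - (q $ i2 + m * p $ i2) / 2"
  define n where "n = - (q $ i3 + m * p $ i3)"
  define X where "X i x = complex_of_real (x $ i - z $ i)" for i and x :: "real ^ 4"
  \<comment> \<open>In coordinates centred at \<open>z\<close>, the equation
    \<open>x\<^sup>1 = X\<close> reads \<open>y * M = N\<close>; here \<open>M\<close> is the
    derivative of \<open>X\<close> in \<open>P\<close>.\<close>
  define M where "M x = k + m * X i2 x + (l + n * X i2 x) * X i4 x" for x
  define N where "N x = X i1 x + q0 * X i2 x - e * (X i2 x)\<^sup>2 - (k + m * X i2 x) * 2 * G * X i4 x
      - (l + n * X i2 x) * (X i3 x + p0 * X i4 x + G * (X i4 x)\<^sup>2)" for x
  define y where "y x = N x / M x" for x
  define P where "P x = p0 + y x" for x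
  \<comment> \<open>This is \<open>- X\<^sub>2\<close>.\<close>
  define Q where "Q x = q0 - 2 * e * X i2 x - m * (y x + 2 * G * X i4 x)
      - n * (X i3 x + P x * X i4 x + G * (X i4 x)\<^sup>2)" for x
  \<comment> \<open>Implicit differentiation of \<open>x\<^sup>1 = X\<close> gives the entries of
    \<open>DP\<close>; the last one uses
    \<open>X\<^sub>4 = P X\<^sub>3 + 2 G X\<^sub>P\<close>.\<close>
  define y3 where "y3 x = - (l + n * X i2 x) / M x" for x
  define DP :: "real ^ 4 \<Rightarrow> complex ^ 4" where "DP x = (\<chi> j. if j = i1 then 1 / M x else if j = i2 then Q x / M x
      else if j = i3 then y3 x else P x * y3 x - 2 * G)" for x
  define DQ :: "real ^ 4 \<Rightarrow> complex ^ 4" where "DQ x = (\<chi> j. - (m + n * X i4 x) * DP x $ j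
      - (if j = i1 then 0 else if j = i2 then 2 * e else if j = i3 then n
         else m * 2 * G + n * (P x + 2 * G * X i4 x)))" for x
  have DP_simps: "DP x $ i1 = 1 / M x" "DP x $ i2 = Q x / M x" "DP x $ i3 = y3 x" "DP x $ i4 = P x * y3 x - 2 * G" for x
    using dist by (auto simp: DP_def)
  have DQ_simps: "DQ x $ i1 = - (m + n * X i4 x) * DP x $ i1" "DQ x $ i2 = - (m + n * X i4 x) * DP x $ i2 - 2 * e"
    "DQ x $ i3 = - (m + n * X i4 x) * DP x $ i3 - n"
    "DQ x $ i4 = - (m + n * X i4 x) * DP x $ i4 - (m * 2 * G + n * (P x + 2 * G * X i4 x))" for x
    using dist by (auto simp: DQ_def)
  have X: "(X i has_derivative (\<lambda>v. of_real (v $ i))) (at x)" for i x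
    unfolding X_def by (rule has_derivative_coordinate)
  have anX: "analytic_at (X i) x" for i x
    unfolding X_def by (rule analytic_at_coordinate)
  have Xz: "X i z = 0" for i by (simp add: X_def)
  have k0: "k \<noteq> 0" using p1 by (simp add: k_def)
  have Mz: "M z = k" and Nz: "N z = 0" by (simp_all add: M_def N_def Xz)

  \<comment> \<open>Since \<open>M z = k\<close> is nonzero, the quotient formulas hold on a
    neighbourhood of \<open>z\<close>.\<close>
  have "isCont M z" unfolding M_def by (intro continuous_intros has_derivative_continuous[OF X])
  then have "(M \<longlongrightarrow> M z) (nhds z)"
    by (simp add: isCont_def tendsto_at_iff_tendsto_nhds)
  then have "\<forall>\<^sub>F x in nhds z. M x \<noteq> 0"
    using k0 Mz by (intro tendsto_imp_eventually_ne) auto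
  then show "\<forall>\<^sub>F x in nhds z. pair_solution_at i1 i2 i3 i4 P Q DP DQ x"
  proof (rule eventually_mono)
    fix x assume Mx: "M x \<noteq> 0"
    let ?v = "\<lambda>i v. complex_of_real (v $ i)"
    define M' where "M' v = m * ?v i2 v + (l + n * X i2 x) * ?v i4 v + n * ?v i2 v * X i4 x" for v
    define N' where "N' v = ?v i1 v + q0 * ?v i2 v - 2 * e * X i2 x * ?v i2 v
        - m * ?v i2 v * 2 * G * X i4 x - (k + m * X i2 x) * 2 * G * ?v i4 v
        - n * ?v i2 v * (X i3 x + p0 * X i4 x + G * (X i4 x)\<^sup>2)
        - (l + n * X i2 x) * (?v i3 v + p0 * ?v i4 v + 2 * G * X i4 x * ?v i4 v)" for v
    define y' where "y' v = ?v i1 v * DP x $ i1 + ?v i2 v * DP x $ i2 + ?v i3 v * DP x $ i3 + ?v i4 v * DP x $ i4" for v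
    have dM: "(M has_derivative M') (at x)"
      unfolding M_def M'_def
      by (rule derivative_eq_intros X refl ext)+ (simp add: algebra_simps)
    have dN: "(N has_derivative N') (at x)"
      unfolding N_def N'_def
      by (rule derivative_eq_intros X refl ext)+ (simp add: algebra_simps)
    have Nx: "N x = y x * M x" using Mx by (simp add: y_def)
    \<comment> \<open>The quotient rule in the form \<open>M dy = dN - y dM\<close>, which leaves a
      polynomial identity.\<close>
    have y'M: "y' v * M x = N' v - y x * M' v" for v
    proof -
      have "y' v * M x = ?v i1 v + ?v i2 v * Q x - ?v i3 v * (l + n * X i2 x)
          + ?v i4 v * (- P x * (l + n * X i2 x) - 2 * G * M x)"
        using Mx by (simp add: y'_def DP_simps y3_def field_simps)
      also have "\<dots> = N' v - y x * M' v"
        unfolding Q_def P_def N'_def M'_def M_def by (simp add: algebra_simps power2_eq_square)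
      finally show ?thesis .
    qed
    have dy: "(y has_derivative y') (at x)"
    proof -
      have "(y has_derivative (\<lambda>v. (N' v * M x - N x * M' v) / (M x * M x))) (at x)"
        unfolding y_def by (rule has_derivative_divide'[OF dN dM Mx])
      moreover have "(N' v * M x - N x * M' v) / (M x * M x) = y' v" for v
      proof -
        have "N' v * M x - N x * M' v = (N' v - y x * M' v) * M x"
          by (simp add: Nx algebra_simps)
        also have "\<dots> = y' v * (M x * M x)"
          by (simp flip: y'M)
        finally show ?thesis using Mx by simp
      qed
      ultimately show ?thesis by simp
    qed
    have dP: "(P has_derivative y') (at x)"
      unfolding P_def using has_derivative_add[OF has_derivative_const dy] by simp
    have "(Q has_derivative (\<lambda>v. - 2 * e * ?v i2 v - m * (y' v + 2 * G * ?v i4 v)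
        - n * (?v i3 v + (P x * ?v i4 v + y' v * X i4 x) + 2 * G * X i4 x * ?v i4 v))) (at x)"
      unfolding Q_def
      by (rule X dy dP derivative_eq_intros refl ext)+ (simp add: algebra_simps)
    moreover have "- 2 * e * ?v i2 v - m * (y' v + 2 * G * ?v i4 v)
        - n * (?v i3 v + (P x * ?v i4 v + y' v * X i4 x) + 2 * G * X i4 x * ?v i4 v)
      = ?v i1 v * DQ x $ i1 + ?v i2 v * DQ x $ i2 + ?v i3 v * DQ x $ i3 + ?v i4 v * DQ x $ i4" for v
      unfolding DQ_simps y'_def by (simp add: algebra_simps)
    ultimately have gQ: "has_gradient Q (DQ x) x"
      unfolding has_gradient_def sum_UNIV_4[OF dist] by simp
    have gP: "has_gradient P (DP x) x"
      using dP unfolding has_gradient_def sum_UNIV_4[OF dist] y'_def .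
    have any: "analytic_at y x"
      unfolding y_def using Mx unfolding N_def M_def power2_eq_square
      by (intro analytic_at_divide analytic_at_add analytic_at_diff analytic_at_mult analytic_at_const anX) auto
    have anP: "analytic_at P x"
      unfolding P_def by (intro analytic_at_add analytic_at_const any)
    have anQ: "analytic_at Q x"
      unfolding Q_def power2_eq_square
      by (intro analytic_at_divide analytic_at_add analytic_at_diff analytic_at_mult analytic_at_const anX anP any)
    \<comment> \<open>The first equation is immediate from \<open>DP\<close>. In the second, the
      terms containing \<open>G\<close> cancel in \<open>DQ x $ i4\<close>, leaving
      \<open>P x * DQ x $ i3\<close>.\<close>
    show "pair_solution_at i1 i2 i3 i4 P Q DP DQ x"
      unfolding pair_solution_at_def
      by (intro conjI anP anQ gP gQ) (simp_all add: DP_simps DQ_simps algebra_simps)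
  qed
  show Pz: "P z = p0" and Qz: "Q z = q0" by (simp_all add: P_def Q_def y_def Nz Xz)
  have "y3 z = p $ i3" using k0 by (simp add: y3_def Mz Xz l_def)
  then show DPz: "DP z = p"
    unfolding vec_eq_iff_4[OF dist] DP_simps Pz Qz Mz
    using p1 p2 by (simp add: k_def G_def diff_divide_distrib)
  \<comment> \<open>The last component is not a free parameter: the choice of \<open>G\<close> turns
    it into \<open>p0 * q $ i3\<close>, which equals \<open>q $ i4\<close> by hypothesis.\<close>
  show "DQ z = q"
    unfolding vec_eq_iff_4[OF dist] DQ_simps DPz Xz Pz
    using p1 q4 by (simp add: k_def m_def e_def n_def G_def diff_divide_distrib add_divide_distrib algebra_simps)
qed

section \<open>Matching an arbitrary admissible first-order jet\<close>

theorem propositionH: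
  fixes z :: "real ^ 4"
    and a b c d :: real
    and A B C D :: "real ^ 4"
  assumes "a \<in> {- pi/2 <..< pi/2}" and "c \<in> {- pi/2 <..< pi/2}"
    and "pde_relation a b c d A B C D"
  shows "\<exists>U \<alpha> \<beta> \<gamma> \<delta>. open U \<and> z \<in> U \<and>
    real_analytic_on \<alpha> U \<and> real_analytic_on \<beta> U \<and>
    real_analytic_on \<gamma> U \<and> real_analytic_on \<delta> U \<and>
    is_solution_on \<alpha> \<beta> \<gamma> \<delta> U \<and>
    \<alpha> z = a \<and> \<beta> z = b \<and> \<gamma> z = c \<and> \<delta> z = d \<and>
    partial_derivs \<alpha> z = A \<and> partial_derivs \<beta> z = B \<and>
    partial_derivs \<gamma> z = C \<and> partial_derivs \<delta> z = D"
proof -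
  have cos: "cos a > 0" "cos c > 0" using assms(1,2) by (auto intro!: cos_gt_zero_pi)
  define p0 where "p0 = \<i> * exp (Complex d (- c))"
  define q0 where "q0 = \<i> * exp (Complex b (- a))"
  \<comment> \<open>By the chain rule, \<open>P = \<i> * exp Z\<close> has partial derivatives
    \<open>P\<close> times those of \<open>Z\<close>; likewise for \<open>Q\<close> and
    \<open>W\<close>.\<close>
  define p :: "complex ^ 4" where "p = (\<chi> j. p0 * Complex (D $ j) (- C $ j))"
  define q :: "complex ^ 4" where "q = (\<chi> j. q0 * Complex (B $ j) (- A $ j))"
  have p2: "p $ 2 = q0 * p $ 1" and q4: "q $ 4 = p0 * q $ 3"
    using assms(3) unfolding pde_relation_complex[OF cos] by (simp_all add: p_def q_def p0_def q0_def)
  have dist: "distinct [1, 2, 3, 4 :: 4]" "distinct [3, 4, 1, 2 :: 4]" by simp_all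
  obtain P Q DP DQ where sol: "\<forall>\<^sub>F x in nhds z. pair_solution_at 1 2 3 4 P Q DP DQ x"
    and PQ: "P z = p0" "Q z = q0" "DP z = p" "DQ z = q"
  proof (cases "p $ 1 = 0")
    case False
    then obtain P Q DP DQ where "\<forall>\<^sub>F x in nhds z. pair_solution_at 1 2 3 4 P Q DP DQ x"
      "P z = p0" "Q z = q0" "DP z = p" "DQ z = q"
      using rational_pair_solution[OF dist(1) p2 q4] by metis
    then show thesis by (rule that)
  next
    case p1: True
    show thesis
    proof (cases "q $ 3 = 0")
      case False
      then obtain Q P DQ DP where "\<forall>\<^sub>F x in nhds z. pair_solution_at 3 4 1 2 Q P DQ DP x"
        "Q z = q0" "P z = p0" "DQ z = q" "DP z = p"
        using rational_pair_solution[OF dist(2) q4 p2] by metis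
      then show thesis by (intro that[of P Q DP DQ]) (simp_all only: pair_solution_swap[of 1 2 3 4])
    next
      case True
      \<comment> \<open>The compatibility relations propagate the vanishing of \<open>p $ 1\<close>
        and \<open>q $ 3\<close>, as the affine solution requires.\<close>
      then have "p $ 2 = 0" "q $ 4 = 0" using p1 p2 q4 by simp_all
      then obtain P Q DP DQ where "\<forall>\<^sub>F x in nhds z. pair_solution_at 1 2 3 4 P Q DP DQ x"
        "P z = p0" "Q z = q0" "DP z = p" "DQ z = q"
        using affine_pair_solution[OF dist(1) p1 _ True] by metis
      then show thesis by (rule that)
    qed
  qed
  show ?thesis
    using assms(1,2) PQ by (intro solution_from_pair[OF sol]) (auto simp: p_def q_def p0_def q0_def)
qed

end
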